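(* If $\mathbb{P}$ is a prime $\omega$-poset then $\mathbb{P}_{\mathsf{S}}=\{p^\in:p\in\mathbb{P}\}$ is an $\omega$-cap-basis for the spectrum $\mathsf{S}\mathbb{P}$.
   Context: Let $(\mathbb{P},\leq)$ be a poset. A subset $S\subseteq\mathbb{P}$ refines $T\subseteq\mathbb{P}$ if for every $s\in S$ there is $t\in T$ with $s\leq t$. A band of $\mathbb{P}$ is a finite subset $B\subseteq\mathbb{P}$ such that every $p\in\mathbb{P}$ is comparable to some $b\in B$. A cap of $\mathbb{P}$ is a subset refined by some band. A selector is a subset $S\subseteq\mathbb{P}$ with $S\cap C\neq\emptyset$ for every cap $C$ of $\mathbb{P}$; a minimal selector is one minimal with respect to inclusion among all selectors. The spectrum $\mathsf{S}\mathbb{P}$ is the set of all minimal selectors, with the topology generated by the subbasis consisting of the sets $p^\in=\{S\in\mathsf{S}\mathbb{P}:p\in S\}$, for $p\in\mathbb{P}$. $\mathbb{P}$ is an $\omega$-poset if every principal filter $p^\leq=\{q\in\mathbb{P}:p\leq q\}$ is finite and, for each $n\in\omega$, the number of principal filters of size $n$ is finite. A poset $\mathbb{P}$ is prime if $p^\in\neq\emptyset$ for all $p\in\mathbb{P}$, i.e. every element of $\mathbb{P}$ lies in some minimal selector. A basis $\mathbb{B}$ of a topological space $X$, ordered by inclusion, is a cap-basis if for all $C\subseteq\mathbb{B}$, $C$ is a cap of the poset $(\mathbb{B},\subseteq)$ if and only if $X=\bigcup C$. It is an $\omega$-cap-basis if it is a cap-basis and also an $\omega$-poset with respect to inclusion.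 *)

theory Defs
  imports "HOL-Analysis.Analysis"
begin

text \<open>
  A poset is given by a carrier \<open>P\<close> together with a relation \<open>r\<close> such that
  \<^term>\<open>partial_order_on P r\<close>, where \<^term>\<open>(p, q) \<in> r\<close> reads \<open>p \<le> q\<close>.  An explicit
  carrier is used because the same notions are applied both to an arbitrary poset
  and to a family of sets ordered by inclusion, i.e. to \<^term>\<open>relation_of (\<subseteq>) B\<close>.
  The carrier may be empty.
\<close>

definition set_refines :: "('a \<times> 'a) set \<Rightarrow> 'a set \<Rightarrow> 'a set \<Rightarrow> bool"
  where "set_refines r S T \<longleftrightarrow> (\<forall>s\<in>S. \<exists>t\<in>T. (s, t) \<in> r)"

definition is_band :: "'a set \<Rightarrow> ('a \<times> 'a) set \<Rightarrow> 'a set \<Rightarrow> bool"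
  where "is_band P r B \<longleftrightarrow>
    finite B \<and> B \<subseteq> P \<and> (\<forall>p\<in>P. \<exists>b\<in>B. (p, b) \<in> r \<or> (b, p) \<in> r)"

definition is_cap :: "'a set \<Rightarrow> ('a \<times> 'a) set \<Rightarrow> 'a set \<Rightarrow> bool"
  where "is_cap P r C \<longleftrightarrow> C \<subseteq> P \<and> (\<exists>B. is_band P r B \<and> set_refines r B C)"

definition is_selector :: "'a set \<Rightarrow> ('a \<times> 'a) set \<Rightarrow> 'a set \<Rightarrow> bool"
  where "is_selector P r S \<longleftrightarrow> S \<subseteq> P \<and> (\<forall>C. is_cap P r C \<longrightarrow> S \<inter> C \<noteq> {})"

definition is_minimal_selector :: "'a set \<Rightarrow> ('a \<times> 'a) set \<Rightarrow> 'a set \<Rightarrow> bool"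
  where "is_minimal_selector P r S \<longleftrightarrow>
    is_selector P r S \<and> (\<forall>T. is_selector P r T \<and> T \<subseteq> S \<longrightarrow> T = S)"

definition spectrum :: "'a set \<Rightarrow> ('a \<times> 'a) set \<Rightarrow> 'a set set"
  where "spectrum P r = {S. is_minimal_selector P r S}"

definition spectrum_nbhd :: "'a set \<Rightarrow> ('a \<times> 'a) set \<Rightarrow> 'a \<Rightarrow> 'a set set"
  where "spectrum_nbhd P r p = {S \<in> spectrum P r. p \<in> S}"

text \<open>
  The restriction \<open>relative_to spectrum P r\<close> makes the empty intersection the whole
  spectrum, so the underlying space is the spectrum even if the subbasis fails to
  cover it.
\<close>

definition spectrum_topology :: "'a set \<Rightarrow> ('a \<times> 'a) set \<Rightarrow> 'a set topology"
  where "spectrum_topology P r =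
    topology (arbitrary union_of
      (finite intersection_of (\<lambda>U. U \<in> spectrum_nbhd P r ` P) relative_to spectrum P r))"

lemma topspace_spectrum_topology [simp]: "topspace (spectrum_topology P r) = spectrum P r"
  by (simp add: spectrum_topology_def)

definition principal_filter :: "'a set \<Rightarrow> ('a \<times> 'a) set \<Rightarrow> 'a \<Rightarrow> 'a set"
  where "principal_filter P r p = {q \<in> P. (p, q) \<in> r}"

definition omega_poset :: "'a set \<Rightarrow> ('a \<times> 'a) set \<Rightarrow> bool"
  where "omega_poset P r \<longleftrightarrow>
    partial_order_on P r \<and>
    (\<forall>p\<in>P. finite (principal_filter P r p)) \<and>
    (\<forall>n::nat. finite {F \<in> principal_filter P r ` P. card F = n})"

definition prime_poset :: "'a set \<Rightarrow> ('a \<times> 'a) set \<Rightarrow> bool"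
  where "prime_poset P r \<longleftrightarrow>
    partial_order_on P r \<and> (\<forall>p\<in>P. spectrum_nbhd P r p \<noteq> {})"

definition is_basis :: "'b topology \<Rightarrow> 'b set set \<Rightarrow> bool"
  where "is_basis X B \<longleftrightarrow> openin X = arbitrary union_of (\<lambda>U. U \<in> B)"

definition cap_basis :: "'b topology \<Rightarrow> 'b set set \<Rightarrow> bool"
  where "cap_basis X B \<longleftrightarrow>
    is_basis X B \<and>
    (\<forall>C\<subseteq>B. is_cap B (relation_of (\<subseteq>) B) C \<longleftrightarrow> topspace X = \<Union>C)"

definition omega_cap_basis :: "'b topology \<Rightarrow> 'b set set \<Rightarrow> bool"
  where "omega_cap_basis X B \<longleftrightarrow> cap_basis X B \<and> omega_poset B (relation_of (\<subseteq>) B)"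

end

theory Submission
  imports Defs
begin

text \<open>
  Write \<open>\<phi> p\<close> for the set of minimal selectors containing \<open>p\<close>.  Everything rests on one
  combinatorial fact about an \<open>\<omega>\<close>-poset (\<open>fine_band\<close>): bands can be chosen so low that no element
  of a prescribed finite set lies strictly below a member of the band, while all but finitely
  many elements of the poset lie below a member outside that set.  In particular any two bands
  have a common refinement.

  A minimal selector \<open>S\<close> is the complement of a maximal non-cap, so minimal selectors abound by
  Zorn's lemma.  Minimality also says that each \<open>s \<in> S\<close> is witnessed by a cap meeting \<open>S\<close> only
  in \<open>s\<close>.  Combined with \<open>fine_band\<close> this shows that \<open>S\<close> is a filter and that all but finitely
  many elements of \<open>S\<close> lie below \<open>s\<close>.

  Being a basis is the filter property.  If the sets \<open>\<phi> d\<close>, \<open>d \<in> D\<close>, cover the spectrum, then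
  \<open>D\<close> meets every minimal selector, hence is a cap, and \<open>\<phi>\<close> maps a band refining \<open>D\<close> to a band.
  Conversely, suppose that the images of a finite set \<open>B\<close> form a band but miss \<open>S\<close>.  Then each
  \<open>\<phi> s\<close> with \<open>s \<in> S\<close> contains some \<open>\<phi> b\<close>; as \<open>S\<close> is directed and \<open>B\<close> finite, one \<open>b\<close> serves all
  \<open>s\<close>.  By primeness there is \<open>T \<in> \<phi> b\<close>; it contains all of \<open>S\<close>, so \<open>T = S\<close>, a contradiction.

  For the \<open>\<omega>\<close>-poset property, let \<open>T \<in> \<phi> p\<close>.  Almost all elements of \<open>T\<close> lie below \<open>p\<close>, so only
  finitely many \<open>\<phi> q\<close> can contain \<open>\<phi> p\<close>.  The same fact shows that a set \<open>Y\<close> with at least two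
  points equals \<open>\<phi> p\<close> for only finitely many \<open>p\<close>.  Sets with at most \<open>n + 1\<close> supersets in the
  basis are then counted from those with at most \<open>n\<close>: let \<open>D\<close> be the finite set of all indices of
  the latter that have two points, and take a band as in \<open>fine_band\<close> for \<open>D\<close>.  Almost every \<open>p\<close>
  lies below some \<open>b\<close> of the band outside \<open>D\<close>.  If \<open>\<phi> b\<close> were strictly larger than \<open>\<phi> p\<close>, it
  would have at most \<open>n\<close> supersets and, \<open>\<phi> p\<close> being nonempty, two points, so \<open>b\<close> would belong
  to \<open>D\<close>.  Hence \<open>\<phi> p = \<phi> b\<close>, which leaves finitely many possibilities.
\<close>

section \<open>Bands and caps in an \<open>\<omega>\<close>-poset\<close>

locale omega_order =
  fixes P :: "'a set" and r :: "('a \<times> 'a) set"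
  assumes omega: "omega_poset P r"
begin

abbreviation le :: "'a \<Rightarrow> 'a \<Rightarrow> bool" (infix \<open>\<sqsubseteq>\<close> 50)
  where "x \<sqsubseteq> y \<equiv> (x, y) \<in> r"

abbreviation nbhd :: "'a \<Rightarrow> 'a set set" (\<open>\<phi>\<close>)
  where "\<phi> \<equiv> spectrum_nbhd P r"

lemma partial_order: "partial_order_on P r"
  using omega by (simp add: omega_poset_def)

lemma le_refl: "p \<in> P \<Longrightarrow> p \<sqsubseteq> p"
  using partial_order by (simp add: partial_order_on_def preorder_on_def refl_on_def)

lemma le_trans: "x \<sqsubseteq> y \<Longrightarrow> y \<sqsubseteq> z \<Longrightarrow> x \<sqsubseteq> z"
  using partial_order by (auto simp: partial_order_on_def preorder_on_def dest: transD)

lemma le_antisym: "x \<sqsubseteq> y \<Longrightarrow> y \<sqsubseteq> x \<Longrightarrow> x = y"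
  using partial_order by (auto simp: partial_order_on_def dest: antisymD)

lemma le_carrier: "x \<sqsubseteq> y \<Longrightarrow> x \<in> P \<and> y \<in> P"
  using partial_order by (auto simp: partial_order_on_def preorder_on_def)

lemma finite_filter: "p \<in> P \<Longrightarrow> finite {q \<in> P. p \<sqsubseteq> q}"
  using omega by (simp add: omega_poset_def principal_filter_def)

text \<open>An element is the least member of its principal filter, so counting filters counts
  elements.\<close>

lemma finite_card_filter_le: "finite {p \<in> P. card {q \<in> P. p \<sqsubseteq> q} \<le> n}"
proof -
  let ?f = "principal_filter P r"
  have "inj_on ?f P"
  proof (rule inj_onI)
    fix x y assume "x \<in> P" "y \<in> P" "?f x = ?f y"
    then have "x \<in> ?f y" "y \<in> ?f x"
      using le_refl by (auto simp: principal_filter_def)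
    then show "x = y"
      using le_antisym by (auto simp: principal_filter_def)
  qed
  then have inj: "inj_on ?f {p \<in> P. card (?f p) \<le> n}"
    by (rule inj_on_subset) auto
  have "finite (\<Union>k\<le>n. {F \<in> ?f ` P. card F = k})"
    using omega by (simp add: omega_poset_def)
  moreover have "?f ` {p \<in> P. card (?f p) \<le> n} \<subseteq> (\<Union>k\<le>n. {F \<in> ?f ` P. card F = k})"
    by auto
  ultimately have "finite {p \<in> P. card (?f p) \<le> n}"
    by (intro finite_imageD[OF _ inj]) (rule finite_subset)
  then show ?thesis
    by (simp add: principal_filter_def)
qed

lemma strict_transp: "transp_on A (\<lambda>x y. x \<sqsubseteq> y \<and> x \<noteq> y)"
  by (rule transp_onI) (use le_trans le_antisym in blast)

lemma strict_asymp: "asymp_on A (\<lambda>x y. x \<sqsubseteq> y \<and> x \<noteq> y)"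
  by (rule asymp_onI) (use le_antisym in blast)

lemma minimal_below:
  assumes "finite A" "A \<subseteq> P" "a \<in> A"
  obtains m where "m \<in> A" "m \<sqsubseteq> a" "\<And>x. x \<in> A \<Longrightarrow> x \<sqsubseteq> m \<Longrightarrow> x = m"
proof -
  let ?D = "{x \<in> A. x \<sqsubseteq> a}"
  have "\<exists>m\<in>?D. \<forall>x\<in>?D. x \<noteq> m \<longrightarrow> \<not> (x \<sqsubseteq> m \<and> x \<noteq> m)"
    using assms le_refl
    by (intro Finite_Set.bex_min_element strict_transp strict_asymp) auto
  then show thesis
    using that le_trans by blast
qed

lemma maximal_above:
  assumes "a \<in> A" "A \<subseteq> P"
  shows "\<exists>m\<in>A. a \<sqsubseteq> m \<and> (\<forall>x\<in>A. m \<sqsubseteq> x \<longrightarrow> x = m)"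
proof -
  let ?D = "{x \<in> A. a \<sqsubseteq> x}"
  have "finite ?D"
    by (rule finite_subset[OF _ finite_filter[of a]]) (use assms in auto)
  then have "\<exists>m\<in>?D. \<forall>x\<in>?D. x \<noteq> m \<longrightarrow> \<not> (m \<sqsubseteq> x \<and> m \<noteq> x)"
    using assms le_refl
    by (intro Finite_Set.bex_max_element strict_transp strict_asymp) auto
  then show ?thesis
    using le_trans by blast
qed

text \<open>The elements just outside the finite up-set \<open>G\<close> generated by \<open>F\<close> have all their strict
  upper bounds in \<open>G\<close>, so their filters have bounded size and there are only finitely many of
  them.  Together with the minimal elements of \<open>G\<close> that have none of them below they form the
  required band.\<close>

lemma fine_band:
  assumes "finite F" "F \<subseteq> P"
  obtains B where "is_band P r B"
    and "\<And>f b. f \<in> F \<Longrightarrow> b \<in> B \<Longrightarrow> f \<sqsubseteq> b \<Longrightarrow> f = b"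
    and "finite {p \<in> P. \<not> (\<exists>b\<in>B - F. p \<sqsubseteq> b)}"
proof -
  define G where "G = (\<Union>f\<in>F. {q \<in> P. f \<sqsubseteq> q})"
  have fin_G: "finite G" and G_P: "G \<subseteq> P"
    using assms finite_filter unfolding G_def by auto
  have F_G: "F \<subseteq> G"
    using assms le_refl by (auto simp: G_def)
  have up_G: "y \<in> G" if "x \<in> G" "x \<sqsubseteq> y" for x y
    using that le_trans le_carrier unfolding G_def by blast
  define M where "M = {m \<in> P - G. \<forall>q\<in>P - G. m \<sqsubseteq> q \<longrightarrow> q = m}"
  have M_P: "M \<subseteq> P"
    by (auto simp: M_def)
  have "card {q \<in> P. m \<sqsubseteq> q} \<le> Suc (card G)" if "m \<in> M" for m
  proof -
    have "{q \<in> P. m \<sqsubseteq> q} \<subseteq> insert m G"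
      using that by (auto simp: M_def)
    then have "card {q \<in> P. m \<sqsubseteq> q} \<le> card (insert m G)"
      using fin_G by (intro card_mono) auto
    also have "\<dots> \<le> Suc (card G)"
      by (rule card_insert_le_m1) auto
    finally show ?thesis .
  qed
  then have fin_M: "finite M"
    using M_P by (intro finite_subset[OF _ finite_card_filter_le[of "Suc (card G)"]]) auto
  have below_M: "\<exists>m\<in>M. p \<sqsubseteq> m" if "p \<in> P - G" for p
    using maximal_above[OF that Diff_subset] unfolding M_def by blast
  define B where "B = {b \<in> G \<union> M. \<forall>x\<in>G \<union> M. x \<sqsubseteq> b \<longrightarrow> x = b}"
  have M_B: "M \<subseteq> B"
    using up_G unfolding B_def M_def by auto
  have "is_band P r B"
    unfolding is_band_def
  proof (intro conjI ballI)
    show "finite B" "B \<subseteq> P"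
      using fin_G fin_M G_P M_P unfolding B_def by auto
    fix p assume "p \<in> P"
    show "\<exists>b\<in>B. p \<sqsubseteq> b \<or> b \<sqsubseteq> p"
    proof (cases "p \<in> G")
      case True
      then obtain m where "m \<in> G \<union> M" "m \<sqsubseteq> p" "\<And>x. x \<in> G \<union> M \<Longrightarrow> x \<sqsubseteq> m \<Longrightarrow> x = m"
        using minimal_below[of "G \<union> M" p] fin_G fin_M G_P M_P by auto
      then show ?thesis
        unfolding B_def by blast
    next
      case False
      then show ?thesis
        using below_M \<open>p \<in> P\<close> M_B by blast
    qed
  qed
  moreover have "f = b" if "f \<in> F" "b \<in> B" "f \<sqsubseteq> b" for f b
    using that F_G unfolding B_def by auto
  moreover have "finite {p \<in> P. \<not> (\<exists>b\<in>B - F. p \<sqsubseteq> b)}"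
  proof (rule finite_subset[OF _ fin_G])
    show "{p \<in> P. \<not> (\<exists>b\<in>B - F. p \<sqsubseteq> b)} \<subseteq> G"
      using below_M M_B F_G unfolding M_def by blast
  qed
  ultimately show thesis
    using that[of B] by blast
qed

text \<open>If no element of \<open>F\<close> lies strictly below an element of \<open>B\<close>, comparability with a band
  inside \<open>F\<close> can only mean lying below it.\<close>

lemma band_refine:
  assumes "finite F" "F \<subseteq> P"
  obtains B where "is_band P r B" "\<And>A. is_band P r A \<Longrightarrow> A \<subseteq> F \<Longrightarrow> set_refines r B A"
    and "finite {p \<in> P. \<not> (\<exists>b\<in>B. p \<sqsubseteq> b)}"
proof (rule fine_band[OF assms])
  fix B
  assume B: "is_band P r B" and low: "\<And>f b. f \<in> F \<Longrightarrow> b \<in> B \<Longrightarrow> f \<sqsubseteq> b \<Longrightarrow> f = b"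
    and fin: "finite {p \<in> P. \<not> (\<exists>b\<in>B - F. p \<sqsubseteq> b)}"
  have "set_refines r B A" if "is_band P r A" "A \<subseteq> F" for A
    unfolding set_refines_def
  proof
    fix b assume "b \<in> B"
    then have "b \<in> P"
      using B by (auto simp: is_band_def)
    then obtain a where "a \<in> A" "b \<sqsubseteq> a \<or> a \<sqsubseteq> b"
      using \<open>is_band P r A\<close> by (auto simp: is_band_def)
    then show "\<exists>a\<in>A. b \<sqsubseteq> a"
      using low[of a b] \<open>b \<in> B\<close> \<open>A \<subseteq> F\<close> by auto
  qed
  moreover have "finite {p \<in> P. \<not> (\<exists>b\<in>B. p \<sqsubseteq> b)}"
    using fin by (rule rev_finite_subset) auto
  ultimately show thesis
    using that B by blast
qed

lemma band_is_cap: "is_band P r B \<Longrightarrow> is_cap P r B"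
  using le_refl unfolding is_cap_def set_refines_def is_band_def by blast

lemma cap_mono: "is_cap P r C \<Longrightarrow> C \<subseteq> D \<Longrightarrow> D \<subseteq> P \<Longrightarrow> is_cap P r D"
  unfolding is_cap_def set_refines_def by blast

section \<open>Minimal selectors\<close>

lemma spectrum_subset: "S \<in> spectrum P r \<Longrightarrow> S \<subseteq> P"
  by (auto simp: spectrum_def is_minimal_selector_def is_selector_def)

lemma spectrum_meets_cap: "S \<in> spectrum P r \<Longrightarrow> is_cap P r C \<Longrightarrow> S \<inter> C \<noteq> {}"
  by (auto simp: spectrum_def is_minimal_selector_def is_selector_def)

lemma spectrum_subset_eq: "S \<in> spectrum P r \<Longrightarrow> T \<in> spectrum P r \<Longrightarrow> T \<subseteq> S \<Longrightarrow> T = S"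
  by (auto simp: spectrum_def is_minimal_selector_def)

lemma spectrum_nonempty: "S \<in> spectrum P r \<Longrightarrow> S \<noteq> {}"
  using band_refine[of "{}"] spectrum_meets_cap band_is_cap by (metis empty_subsetI finite.emptyI inf_bot_left)

text \<open>Since bands are finite, the non-caps are closed under unions of chains; the complement of a
  maximal non-cap is a minimal selector.\<close>

lemma minimal_selector_avoiding:
  assumes "D \<subseteq> P" "\<not> is_cap P r D"
  obtains S where "S \<in> spectrum P r" "S \<inter> D = {}"
proof -
  define \<A> where "\<A> = {U. D \<subseteq> U \<and> U \<subseteq> P \<and> \<not> is_cap P r U}"
  have "\<exists>M\<in>\<A>. \<forall>X\<in>\<A>. M \<subseteq> X \<longrightarrow> X = M"
  proof (rule subset_Zorn_nonempty)
    show "\<A> \<noteq> {}"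
      using assms by (auto simp: \<A>_def)
    fix \<C> assume ne: "\<C> \<noteq> {}" and chain: "subset.chain \<A> \<C>"
    have sub: "\<C> \<subseteq> \<A>"
      using chain by (simp add: subset.chain_def)
    have "\<not> is_cap P r (\<Union>\<C>)"
    proof
      assume "is_cap P r (\<Union>\<C>)"
      then obtain B where B: "is_band P r B" "set_refines r B (\<Union>\<C>)"
        by (auto simp: is_cap_def)
      then obtain t where t: "\<And>b. b \<in> B \<Longrightarrow> t b \<in> \<Union>\<C> \<and> b \<sqsubseteq> t b"
        unfolding set_refines_def by metis
      have "finite (t ` B)" "t ` B \<subseteq> \<Union>\<C>"
        using B t by (auto simp: is_band_def)
      then obtain U where "U \<in> \<C>" "t ` B \<subseteq> U"
        using finite_subset_Union_chain ne chain by metis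
      then have "set_refines r B U"
        using t unfolding set_refines_def by blast
      then have "is_cap P r U"
        using B \<open>U \<in> \<C>\<close> sub unfolding is_cap_def \<A>_def by blast
      then show False
        using \<open>U \<in> \<C>\<close> sub by (auto simp: \<A>_def)
    qed
    then show "\<Union>\<C> \<in> \<A>"
      using ne sub unfolding \<A>_def by blast
  qed
  then obtain M where M: "D \<subseteq> M" "M \<subseteq> P" "\<not> is_cap P r M"
    and max: "\<And>X. X \<in> \<A> \<Longrightarrow> M \<subseteq> X \<Longrightarrow> X = M"
    by (auto simp: \<A>_def)
  have sel: "is_selector P r (P - M)"
    using M(2,3) cap_mono unfolding is_selector_def is_cap_def by blast
  have "T = P - M" if T: "is_selector P r T" "T \<subseteq> P - M" for T
  proof -
    have "\<not> is_cap P r (P - T)"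
      using T(1) by (auto simp: is_selector_def)
    then have "P - T = M"
      using T M by (intro max) (auto simp: \<A>_def)
    then show ?thesis
      using T by blast
  qed
  then have "P - M \<in> spectrum P r"
    using sel by (simp add: spectrum_def is_minimal_selector_def)
  then show thesis
    using that M by blast
qed

lemma cap_iff_meets_spectrum:
  assumes "D \<subseteq> P"
  shows "is_cap P r D \<longleftrightarrow> (\<forall>S\<in>spectrum P r. S \<inter> D \<noteq> {})"
  using minimal_selector_avoiding[OF assms] spectrum_meets_cap by metis

text \<open>Removing \<open>s\<close> from \<open>S\<close> must destroy the selector property.\<close>

lemma witnessing_cap:
  assumes "S \<in> spectrum P r" "s \<in> S"
  obtains C where "is_cap P r C" "S \<inter> C = {s}"
proof -
  have "\<not> is_selector P r (S - {s})"
    using assms unfolding spectrum_def is_minimal_selector_def by blast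
  then obtain C where "is_cap P r C" "(S - {s}) \<inter> C = {}"
    using spectrum_subset[OF assms(1)] unfolding is_selector_def by blast
  then show thesis
    using that spectrum_meets_cap[OF assms(1)] by blast
qed

lemma minimal_selector_upclosed:
  assumes S: "S \<in> spectrum P r" and "s \<in> S" "s \<sqsubseteq> t"
  shows "t \<in> S"
proof (rule ccontr)
  assume "t \<notin> S"
  obtain C where C: "is_cap P r C" "S \<inter> C = {s}"
    using witnessing_cap S \<open>s \<in> S\<close> by blast
  \<comment> \<open>Raising \<open>s\<close> to \<open>t\<close> keeps \<open>C\<close> a cap but removes its only point in \<open>S\<close>.\<close>
  have "is_cap P r (insert t (C - {s}))"
  proof -
    obtain B where B: "is_band P r B" "set_refines r B C" and "C \<subseteq> P"
      using C(1) by (auto simp: is_cap_def)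
    have "set_refines r B (insert t (C - {s}))"
      unfolding set_refines_def
    proof
      fix b assume "b \<in> B"
      then obtain c where "c \<in> C" "b \<sqsubseteq> c"
        using B(2) by (auto simp: set_refines_def)
      then show "\<exists>c\<in>insert t (C - {s}). b \<sqsubseteq> c"
        using le_trans[OF _ \<open>s \<sqsubseteq> t\<close>] by (cases "c = s") auto
    qed
    then show ?thesis
      using B(1) \<open>C \<subseteq> P\<close> le_carrier[OF \<open>s \<sqsubseteq> t\<close>] unfolding is_cap_def by blast
  qed
  then show False
    using spectrum_meets_cap[OF S] C(2) \<open>t \<notin> S\<close> by blast
qed

text \<open>A band refining the witnessing cap meets \<open>S\<close> only below \<open>s\<close>: above any of its points in
  \<open>S\<close> there is a point of the cap, which lies in \<open>S\<close> and hence is \<open>s\<close>.\<close>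

lemma witnessing_band:
  assumes S: "S \<in> spectrum P r" and "s \<in> S"
  obtains B where "is_band P r B" "\<And>b. b \<in> S \<inter> B \<Longrightarrow> b \<sqsubseteq> s"
proof -
  obtain C where C: "is_cap P r C" "S \<inter> C = {s}"
    using witnessing_cap assms by blast
  then obtain B where B: "is_band P r B" "set_refines r B C"
    by (auto simp: is_cap_def)
  have "b \<sqsubseteq> s" if b: "b \<in> S \<inter> B" for b
  proof -
    obtain c where "c \<in> C" "b \<sqsubseteq> c"
      using B(2) b unfolding set_refines_def by blast
    then have "c \<in> S \<inter> C"
      using minimal_selector_upclosed[OF S, of b] b by blast
    then show ?thesis
      using C(2) \<open>b \<sqsubseteq> c\<close> by simp
  qed
  then show thesis
    using that B by blast
qed

lemma minimal_selector_directed: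
  assumes S: "S \<in> spectrum P r" and "s \<in> S" "t \<in> S"
  obtains u where "u \<in> S" "u \<sqsubseteq> s" "u \<sqsubseteq> t"
proof -
  obtain A where A: "is_band P r A" "\<And>b. b \<in> S \<inter> A \<Longrightarrow> b \<sqsubseteq> s"
    using witnessing_band S \<open>s \<in> S\<close> by blast
  obtain A' where A': "is_band P r A'" "\<And>b. b \<in> S \<inter> A' \<Longrightarrow> b \<sqsubseteq> t"
    using witnessing_band S \<open>t \<in> S\<close> by blast
  obtain B where B: "is_band P r B" "set_refines r B A" "set_refines r B A'"
    using band_refine[of "A \<union> A'"] A(1) A'(1) unfolding is_band_def
    by (metis (no_types, lifting) Un_least Un_upper1 Un_upper2 finite_UnI)
  then obtain u where "u \<in> S" "u \<in> B"
    using spectrum_meets_cap[OF S band_is_cap] by blast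
  then have "u \<sqsubseteq> s" "u \<sqsubseteq> t"
    using B A(2) A'(2) minimal_selector_upclosed[OF S] le_trans
    unfolding set_refines_def by blast+
  then show thesis
    using that \<open>u \<in> S\<close> by blast
qed

lemma minimal_selector_lower_bound:
  assumes S: "S \<in> spectrum P r" and "finite A" "A \<subseteq> S"
  shows "\<exists>u\<in>S. \<forall>a\<in>A. u \<sqsubseteq> a"
  using assms(2,3)
proof (induction A rule: finite_induct)
  case empty
  then show ?case
    using spectrum_nonempty[OF S] by blast
next
  case (insert a A)
  then obtain u where "u \<in> S" "\<forall>a\<in>A. u \<sqsubseteq> a"
    by auto
  moreover obtain v where "v \<in> S" "v \<sqsubseteq> u" "v \<sqsubseteq> a"
    using minimal_selector_directed[OF S \<open>u \<in> S\<close>] insert.prems by blast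
  ultimately show ?case
    using le_trans by blast
qed

text \<open>Almost every \<open>q \<in> S\<close> lies below a band refining the witnessing band of \<open>s\<close>, and then, \<open>S\<close>
  being an up-set, below \<open>s\<close>.\<close>

lemma finite_not_below:
  assumes S: "S \<in> spectrum P r" and "s \<in> S"
  shows "finite {q \<in> S. \<not> q \<sqsubseteq> s}"
proof -
  obtain A where A: "is_band P r A" "\<And>b. b \<in> S \<inter> A \<Longrightarrow> b \<sqsubseteq> s"
    using witnessing_band assms by blast
  obtain B where B: "set_refines r B A" "finite {p \<in> P. \<not> (\<exists>b\<in>B. p \<sqsubseteq> b)}"
  proof (rule band_refine[of A])
    show "finite A" "A \<subseteq> P"
      using A(1) by (simp_all add: is_band_def)
  qed (use A(1) in blast)
  have "q \<sqsubseteq> s" if q: "q \<in> S" "b \<in> B" "q \<sqsubseteq> b" for q b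
  proof -
    obtain a where "a \<in> A" "b \<sqsubseteq> a"
      using B(1) q by (auto simp: set_refines_def)
    then have "q \<sqsubseteq> a"
      using q le_trans by blast
    then show ?thesis
      using A(2) \<open>a \<in> A\<close> q minimal_selector_upclosed[OF S] le_trans by blast
  qed
  then have "{q \<in> S. \<not> q \<sqsubseteq> s} \<subseteq> {p \<in> P. \<not> (\<exists>b\<in>B. p \<sqsubseteq> b)}"
    using spectrum_subset[OF S] by blast
  then show ?thesis
    using B(2) finite_subset by blast
qed

section \<open>The basis of the spectrum\<close>

lemma nbhd_iff: "S \<in> \<phi> p \<longleftrightarrow> S \<in> spectrum P r \<and> p \<in> S"
  by (simp add: spectrum_nbhd_def)

lemma nbhd_mono: "p \<sqsubseteq> q \<Longrightarrow> \<phi> p \<subseteq> \<phi> q"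
  using minimal_selector_upclosed by (auto simp: nbhd_iff)

lemma spectrum_is_basis: "is_basis (spectrum_topology P r) (\<phi> ` P)"
  unfolding is_basis_def openin_topology_base_unique
proof (intro conjI allI impI)
  let ?I = "finite intersection_of (\<lambda>U. U \<in> \<phi> ` P) relative_to spectrum P r"
  have open_eq: "openin (spectrum_topology P r) = arbitrary union_of ?I"
    unfolding spectrum_topology_def using openin_subbase by blast
  {
    fix V assume V: "V \<in> \<phi> ` P"
    then have "spectrum P r \<inter> V = V"
      by (auto simp: nbhd_iff)
    moreover have "(finite intersection_of (\<lambda>U. U \<in> \<phi> ` P)) V"
      using V by (rule finite_intersection_of_inc)
    ultimately have "?I V"
      unfolding relative_to_def by blast
    then show "openin (spectrum_topology P r) V"
      unfolding open_eq by (rule arbitrary_union_of_inc)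
  }
  fix U S assume "openin (spectrum_topology P r) U \<and> S \<in> U"
  then obtain W where W: "?I W" "S \<in> W" "W \<subseteq> U"
    unfolding open_eq union_of_def by blast
  then obtain \<F> where \<F>: "finite \<F>" "\<F> \<subseteq> \<phi> ` P" "W = spectrum P r \<inter> \<Inter>\<F>"
    unfolding relative_to_def intersection_of_def by auto
  then obtain A where A: "A \<subseteq> P" "finite A" "\<F> = \<phi> ` A"
    by (metis finite_subset_image)
  have S: "S \<in> spectrum P r" and "A \<subseteq> S"
    using W \<F> A by (auto simp: nbhd_iff)
  then obtain u where u: "u \<in> S" "\<forall>a\<in>A. u \<sqsubseteq> a"
    using minimal_selector_lower_bound A by blast
  have "\<phi> u \<subseteq> W"
    unfolding \<F>(3) A(3) using u(2) nbhd_mono by (auto simp: nbhd_iff)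
  then show "\<exists>V. V \<in> \<phi> ` P \<and> S \<in> V \<and> V \<subseteq> U"
    using u(1) S W(3) spectrum_subset[OF S] nbhd_iff by blast
qed

abbreviation basis :: "'a set set set"
  where "basis \<equiv> \<phi> ` P"

text \<open>A set of indices of a covering meets every minimal selector and is therefore a cap of the
  poset; the monotone map \<open>\<phi>\<close> carries the band refining it over to the basis.\<close>

lemma cap_of_covering:
  assumes "C \<subseteq> basis" "spectrum P r = \<Union>C"
  shows "is_cap basis (relation_of (\<subseteq>) basis) C"
proof -
  obtain D where D: "D \<subseteq> P" "C = \<phi> ` D"
    using assms(1) by (auto simp: subset_image_iff)
  have "S \<inter> D \<noteq> {}" if S: "S \<in> spectrum P r" for S
  proof -
    obtain d where "d \<in> D" "S \<in> \<phi> d"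
      using S D(2) unfolding assms(2) by blast
    then show ?thesis
      unfolding nbhd_iff by blast
  qed
  then have "is_cap P r D"
    using cap_iff_meets_spectrum D by blast
  then obtain B where B: "is_band P r B" "set_refines r B D"
    by (auto simp: is_cap_def)
  have B_P: "B \<subseteq> P"
    using B by (simp add: is_band_def)
  have "is_band basis (relation_of (\<subseteq>) basis) (\<phi> ` B)"
    unfolding is_band_def
  proof (intro conjI ballI)
    show "finite (\<phi> ` B)" "\<phi> ` B \<subseteq> basis"
      using B by (auto simp: is_band_def)
    fix X assume "X \<in> basis"
    then obtain p where p: "p \<in> P" "X = \<phi> p"
      by blast
    then obtain b where b: "b \<in> B" "p \<sqsubseteq> b \<or> b \<sqsubseteq> p"
      using B by (auto simp: is_band_def)
    then have "X \<subseteq> \<phi> b \<or> \<phi> b \<subseteq> X"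
      using nbhd_mono p(2) by blast
    then show "\<exists>Y\<in>\<phi> ` B. (X, Y) \<in> relation_of (\<subseteq>) basis \<or> (Y, X) \<in> relation_of (\<subseteq>) basis"
      using b(1) p B_P by (intro bexI[of _ "\<phi> b"]) (auto simp: relation_of_def)
  qed
  moreover have "set_refines (relation_of (\<subseteq>) basis) (\<phi> ` B) C"
    unfolding set_refines_def
  proof
    fix X assume "X \<in> \<phi> ` B"
    then obtain b where b: "b \<in> B" "X = \<phi> b"
      by blast
    then obtain d where "d \<in> D" "b \<sqsubseteq> d"
      using B by (auto simp: set_refines_def)
    then show "\<exists>Y\<in>C. (X, Y) \<in> relation_of (\<subseteq>) basis"
      using nbhd_mono b D B_P unfolding relation_of_def by blast
  qed
  ultimately show ?thesis
    using assms(1) unfolding is_cap_def by blast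
qed

end

locale prime_omega_order = omega_order +
  assumes prime: "prime_poset P r"
begin

lemma nbhd_nonempty: "p \<in> P \<Longrightarrow> \<phi> p \<noteq> {}"
  using prime by (simp add: prime_poset_def)

text \<open>A point \<open>S\<close> missed by the band forces a fixed member \<open>Y\<close> of the band to lie inside all
  neighbourhoods \<open>\<phi> s\<close> of \<open>S\<close>.  Primeness supplies a point of \<open>Y\<close>; it contains
  every \<open>s \<in> S\<close>, so by minimality it can only be \<open>S\<close>.\<close>

lemma band_covers:
  assumes band: "is_band basis (relation_of (\<subseteq>) basis) \<B>" and S: "S \<in> spectrum P r"
  shows "S \<in> \<Union>\<B>"
proof (rule ccontr)
  assume S_out: "S \<notin> \<Union>\<B>"
  have fin: "finite \<B>" and sub: "\<B> \<subseteq> basis"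
    using band by (auto simp: is_band_def)
  have contains: "\<exists>Y\<in>\<B>. Y \<subseteq> \<phi> s" if "s \<in> S" for s
  proof -
    have "\<phi> s \<in> basis" "S \<in> \<phi> s"
      using that S spectrum_subset[OF S] by (auto simp: nbhd_iff)
    then obtain Y where "Y \<in> \<B>" "\<phi> s \<subseteq> Y \<or> Y \<subseteq> \<phi> s"
      using band unfolding is_band_def relation_of_def by auto
    then show ?thesis
      using S_out \<open>S \<in> \<phi> s\<close> by blast
  qed
  \<comment> \<open>The choice of \<open>Y\<close> can be made independent of \<open>s\<close>: otherwise take a lower bound in \<open>S\<close> of
    one counterexample for each of the finitely many \<open>Y\<close>.\<close>
  have "\<exists>Y\<in>\<B>. \<forall>s\<in>S. Y \<subseteq> \<phi> s"
  proof (rule ccontr)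
    assume "\<not> ?thesis"
    then obtain f where f: "\<And>Y. Y \<in> \<B> \<Longrightarrow> f Y \<in> S \<and> \<not> Y \<subseteq> \<phi> (f Y)"
      by metis
    then obtain u where "u \<in> S" "\<forall>a\<in>f ` \<B>. u \<sqsubseteq> a"
      using minimal_selector_lower_bound[OF S, of "f ` \<B>"] fin by auto
    then show False
      using contains f nbhd_mono by (metis image_eqI subset_trans)
  qed
  then obtain Y where Y: "Y \<in> \<B>" "\<forall>s\<in>S. Y \<subseteq> \<phi> s"
    by blast
  then obtain T where T: "T \<in> Y"
    using sub nbhd_nonempty by blast
  have "T \<in> spectrum P r"
    using Y T sub by (auto simp: nbhd_iff)
  moreover have "S \<subseteq> T"
    using Y(2) T nbhd_iff by blast
  ultimately have "S = T"
    using spectrum_subset_eq S by blast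
  then show False
    using S_out Y T by blast
qed

lemma spectrum_cap_basis: "cap_basis (spectrum_topology P r) basis"
  unfolding cap_basis_def
proof (intro conjI allI impI spectrum_is_basis)
  fix C assume C: "C \<subseteq> basis"
  show "is_cap basis (relation_of (\<subseteq>) basis) C \<longleftrightarrow> topspace (spectrum_topology P r) = \<Union>C"
  proof
    assume "is_cap basis (relation_of (\<subseteq>) basis) C"
    then obtain \<B> where \<B>: "is_band basis (relation_of (\<subseteq>) basis) \<B>"
      "set_refines (relation_of (\<subseteq>) basis) \<B> C"
      by (auto simp: is_cap_def)
    then have "\<Union>\<B> \<subseteq> \<Union>C"
      unfolding set_refines_def relation_of_def by blast
    moreover have "\<Union>C \<subseteq> spectrum P r"
      using C by (auto simp: nbhd_iff)
    ultimately show "topspace (spectrum_topology P r) = \<Union>C"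
      using band_covers[OF \<B>(1)] by auto
  next
    assume "topspace (spectrum_topology P r) = \<Union>C"
    then show "is_cap basis (relation_of (\<subseteq>) basis) C"
      using cap_of_covering C by simp
  qed
qed

section \<open>The basis is an \<open>\<omega>\<close>-poset\<close>

text \<open>Any \<open>T \<in> \<phi> p\<close> belongs to every \<open>\<phi> q\<close> above \<open>\<phi> p\<close>; almost all elements \<open>q\<close> of \<open>T\<close> lie
  below \<open>p\<close>, and those yield only \<open>\<phi> p\<close> itself.\<close>

lemma finite_supersets:
  assumes "X \<in> basis"
  shows "finite {Y \<in> basis. X \<subseteq> Y}"
proof -
  obtain p where p: "p \<in> P" "X = \<phi> p"
    using assms by blast
  then obtain T where T: "T \<in> spectrum P r" "p \<in> T"
    using nbhd_nonempty[OF p(1)] nbhd_iff by blast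
  have "Y \<in> insert X (\<phi> ` {q \<in> T. \<not> q \<sqsubseteq> p})" if Y: "Y \<in> basis" "X \<subseteq> Y" for Y
  proof -
    obtain q where q: "q \<in> P" "Y = \<phi> q"
      using Y by blast
    then have "q \<in> T"
      using Y T p nbhd_iff by blast
    then show ?thesis
      using q p Y nbhd_mono[of q p] by blast
  qed
  then have "{Y \<in> basis. X \<subseteq> Y} \<subseteq> insert X (\<phi> ` {q \<in> T. \<not> q \<sqsubseteq> p})"
    by blast
  then show ?thesis
    using finite_not_below[OF T] by (meson finite.insertI finite_imageI finite_subset)
qed

text \<open>If infinitely many \<open>p\<close> had \<open>\<phi> p = Y\<close>, then below each element of any \<open>S \<in> Y\<close> there would
  be one of them, which belongs to every \<open>T \<in> Y\<close>.  This makes \<open>S \<subseteq> T\<close>, hence \<open>S = T\<close>.\<close>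

lemma finite_indices:
  assumes "S \<in> Y" "T \<in> Y" "S \<noteq> T"
  shows "finite {p \<in> P. \<phi> p = Y}"
proof (cases "{p \<in> P. \<phi> p = Y} = {}")
  case True
  show ?thesis
    unfolding True by (rule finite.emptyI)
next
  case False
  then have S: "S \<in> spectrum P r" and T: "T \<in> spectrum P r"
    using assms by (auto simp: nbhd_iff)
  have "\<not> S \<subseteq> T"
    using spectrum_subset_eq S T \<open>S \<noteq> T\<close> by blast
  then obtain s where s: "s \<in> S" "s \<notin> T"
    by blast
  have "{p \<in> P. \<phi> p = Y} \<subseteq> {q \<in> S. \<not> q \<sqsubseteq> s}"
    using assms(1,2) s minimal_selector_upclosed[OF T] nbhd_iff by blast
  then show ?thesis
    using finite_not_below[OF S s(1)] finite_subset by blast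
qed

text \<open>The induction is the substitute for ranks: the basis elements counted at stage \<open>n + 1\<close> are
  images of a finite band or of the finitely many elements not controlled by it.\<close>

lemma finite_few_supersets: "finite {X \<in> basis. card {Y \<in> basis. X \<subseteq> Y} \<le> n}"
proof (induction n)
  case 0
  have "card {Y \<in> basis. X \<subseteq> Y} \<noteq> 0" if "X \<in> basis" for X
    using finite_supersets[OF that] that by (subst card_0_eq) blast+
  then have empty: "{X \<in> basis. card {Y \<in> basis. X \<subseteq> Y} \<le> 0} = {}"
    by blast
  show ?case
    unfolding empty by (rule finite.emptyI)
next
  case (Suc n)
  define \<F> where "\<F> = {Y \<in> basis. card {Z \<in> basis. Y \<subseteq> Z} \<le> n \<and> (\<exists>S\<in>Y. \<exists>T\<in>Y. S \<noteq> T)}"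
  define D where "D = (\<Union>Y\<in>\<F>. {p \<in> P. \<phi> p = Y})"
  have "finite \<F>"
    using Suc.IH by (rule rev_finite_subset) (auto simp: \<F>_def)
  then have fin_D: "finite D"
    unfolding D_def by (rule finite_UN_I) (use finite_indices in \<open>auto simp: \<F>_def\<close>)
  have "D \<subseteq> P"
    by (auto simp: D_def)
  obtain B where B: "is_band P r B" "finite {p \<in> P. \<not> (\<exists>b\<in>B - D. p \<sqsubseteq> b)}"
    by (rule fine_band[OF fin_D \<open>D \<subseteq> P\<close>]) (rule that; assumption)
  let ?E = "{p \<in> P. \<not> (\<exists>b\<in>B - D. p \<sqsubseteq> b)}"
  have "X \<in> \<phi> ` (?E \<union> B)" if X: "X \<in> basis" "card {Y \<in> basis. X \<subseteq> Y} \<le> Suc n" for X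
  proof (cases "X \<in> \<phi> ` ?E")
    case False
    obtain p where p: "p \<in> P" "X = \<phi> p"
      using X by blast
    then obtain b where b: "b \<in> B" "b \<notin> D" "p \<sqsubseteq> b"
      using False by blast
    have "b \<in> P" and X_b: "X \<subseteq> \<phi> b"
      using le_carrier nbhd_mono b p by blast+
    have "X = \<phi> b"
    proof (rule ccontr)
      assume "X \<noteq> \<phi> b"
      \<comment> \<open>A strictly larger set has fewer supersets and, as \<open>X\<close> is nonempty, two points, so
        \<open>b\<close> would be one of the indices in \<open>D\<close>.\<close>
      have "{Z \<in> basis. \<phi> b \<subseteq> Z} \<subset> {Z \<in> basis. X \<subseteq> Z}"
        using X_b \<open>X \<noteq> \<phi> b\<close> X(1) by blast
      then have "card {Z \<in> basis. \<phi> b \<subseteq> Z} < card {Z \<in> basis. X \<subseteq> Z}"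
        using finite_supersets[OF X(1)] by (rule psubset_card_mono[rotated])
      then have "card {Z \<in> basis. \<phi> b \<subseteq> Z} \<le> n"
        using X(2) by linarith
      moreover have "\<exists>S\<in>\<phi> b. \<exists>T\<in>\<phi> b. S \<noteq> T"
      proof -
        obtain S T where "S \<in> X" "T \<in> \<phi> b" "T \<notin> X"
          using nbhd_nonempty[OF p(1)] X_b \<open>X \<noteq> \<phi> b\<close> unfolding p(2) by blast
        then show ?thesis
          using X_b by (metis subsetD)
      qed
      ultimately have "b \<in> D"
        using \<open>b \<in> P\<close> unfolding D_def \<F>_def by blast
      then show False
        using b by blast
    qed
    then show ?thesis
      using b by blast
  qed blast
  then have "{X \<in> basis. card {Y \<in> basis. X \<subseteq> Y} \<le> Suc n} \<subseteq> \<phi> ` (?E \<union> B)"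
    by blast
  moreover have "finite (\<phi> ` (?E \<union> B))"
    using B by (simp add: is_band_def)
  ultimately show ?case
    by (rule finite_subset)
qed

lemma basis_omega_poset: "omega_poset basis (relation_of (\<subseteq>) basis)"
proof -
  let ?f = "principal_filter basis (relation_of (\<subseteq>) basis)"
  have eq: "?f X = {Y \<in> basis. X \<subseteq> Y}" if "X \<in> basis" for X
    using that by (auto simp: principal_filter_def relation_of_def)
  have "finite {F \<in> ?f ` basis. card F = n}" for n
  proof (rule finite_subset)
    show "{F \<in> ?f ` basis. card F = n} \<subseteq> ?f ` {X \<in> basis. card {Y \<in> basis. X \<subseteq> Y} \<le> n}"
      using eq by fastforce
  qed (intro finite_imageI finite_few_supersets)
  moreover have "partial_order_on basis (relation_of (\<subseteq>) basis)"
    by (rule partial_order_on_relation_ofI) auto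
  moreover have "finite (?f X)" if "X \<in> basis" for X
    using finite_supersets[OF that] eq[OF that] by simp
  ultimately show ?thesis
    by (simp add: omega_poset_def)
qed

end

theorem theorem2p29:
  fixes P :: "'a set" and r :: "('a \<times> 'a) set"
  assumes "omega_poset P r"
    and "prime_poset P r"
  shows "omega_cap_basis (spectrum_topology P r) (spectrum_nbhd P r ` P)"
proof -
  interpret prime_omega_order P r
    by unfold_locales (fact assms)+
  show ?thesis
    using spectrum_cap_basis basis_omega_poset by (simp add: omega_cap_basis_def)
qed

end
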